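(* (a) $\mathcal{P}$ is a commutative algebra under pointwise multiplication. In fact, for all finite simple graphs $H_1,H_2$, $$[H_1][H_2]=\sum_H c_H[H],$$ where the sum is over (isomorphism classes of) finite simple graphs $H$ on at most $|V(H_1)|+|V(H_2)|$ vertices, and $c_H$ is the number of ordered pairs $(F_1,F_2)$ of induced subgraphs of $H$ (possibly sharing some vertices) such that $F_i$ is isomorphic to $H_i$ for $i=1,2$ and $V(F_1)\cup V(F_2)=V(H)$. (b) It follows that $\mathcal{P}$ is a quotient of the polynomial algebra over $\mathbb{Q}$ on the set $[\mathcal{G}^c]=\{[H]: H \text{ a connected finite simple graph}\}$; i.e. the functions $[H]$ with $H$ connected generate $\mathcal{P}$ as a $\mathbb{Q}$-algebra.
   Context: $\mathcal{G}$ is the set of isomorphism classes of finite simple graphs (no loops, no multiple edges), including the empty graph; $\mathcal{G}^c$ is the subset of (nonempty) connected graphs. For $H,G\in\mathcal{G}$, an embedding $H\to G$ is an injection $f:V(H)\to V(G)$ such that for all $v,v'\in V(H)$, $(v,v')$ is an edge of $H$ if and only if $(f(v),f(v'))$ is an edge of $G$. $i(H,G)$ is the number of embeddings of $H$ in $G$ divided by the number of automorphisms of $H$ (equivalently, the number of subsets $S\subseteq V(G)$ with $G[S]\cong H$). $[H]:\mathcal{G}\to\mathbb{N}$ is the function $G\mapsto i(H,G)$; thus $[\emptyset]$ is the constant function $1$. $\mathcal{P}$ is the $\mathbb{Q}$-vector space spanned by $\{[H]:H\in\mathcal{G}\}$ inside the functions $\mathcal{G}\to\mathbb{Q}$. 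*)

theory Defs
  imports
    "Graph_Theory.Digraph_Isomorphism"
    "HOL-Library.FuncSet"
    "HOL-Library.Function_Algebras"
    "HOL-Library.Poly_Mapping"
    "HOL-Algebra.Module"
    "HOL-Algebra.QuotRing"
begin

section \<open>Isomorphism classes of finite simple graphs\<close>

text \<open>
  A finite simple graph is a \<^locale>\<open>pair_graph\<close>: finitely many vertices, and a symmetric,
  irreflexive set of arcs (one pair in each direction for every edge); the empty graph is included.
  Every finite simple graph is isomorphic to one whose vertices are natural numbers, so graphs on
  \<^typ>\<open>nat\<close> represent all isomorphism classes.
\<close>

definition graph_rel :: "nat pair_pre_digraph \<Rightarrow> nat pair_pre_digraph \<Rightarrow> bool" where
  "graph_rel G H \<longleftrightarrow> pair_graph G \<and> pair_graph H \<and> digraph_iso (with_proj G) (with_proj H)"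

definition empty_graph :: "nat pair_pre_digraph" where
  "empty_graph = \<lparr>pverts = {}, parcs = {}\<rparr>"

lemma pair_graph_empty: "pair_graph empty_graph"
  by unfold_locales (auto simp: empty_graph_def symmetric_def sym_def)

lemma pair_graph_wf: "pair_graph G \<Longrightarrow> wf_digraph (with_proj G)"
  unfolding wf_digraph_wp_iff pair_graph_def pair_digraph_def pair_fin_digraph_def by simp

lemma pair_graph_finite: "pair_graph G \<Longrightarrow> finite (pverts G)"
  and pair_graph_finite_arcs: "pair_graph G \<Longrightarrow> finite (parcs G)"
  by (auto simp: pair_graph_def pair_digraph_def pair_fin_digraph_def pair_fin_digraph_axioms_def)

lemma digraph_isoE:
  assumes "digraph_iso (with_proj G) (with_proj H)"
  obtains f where "bij_betw f (pverts G) (pverts H)" "parcs H = map_prod f f ` parcs G"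
proof -
  from assms obtain h where h: "pre_digraph.digraph_isomorphism (with_proj G) h"
    and H: "with_proj H = app_iso h (with_proj G)"
    unfolding digraph_iso_def by blast
  let ?f = "iso_verts h"
  have t: "iso_tail h = fst" "iso_head h = snd"
    using arg_cong[OF H, of tail] arg_cong[OF H, of head] by auto
  have inj: "inj_on ?f (pverts G)"
    and ar: "\<And>a. a \<in> parcs G \<Longrightarrow> iso_arcs h a = map_prod ?f ?f a"
    using h t by (auto simp: pre_digraph.digraph_isomorphism_def prod_eq_iff)
  have v: "pverts H = ?f ` pverts G" and a: "parcs H = iso_arcs h ` parcs G"
    using arg_cong[OF H, of verts] arg_cong[OF H, of arcs] by auto
  show ?thesis
  proof
    show "bij_betw ?f (pverts G) (pverts H)" using inj v by (simp add: bij_betw_def)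
    show "parcs H = map_prod ?f ?f ` parcs G" unfolding a by (rule image_cong[OF refl ar])
  qed
qed

lemma digraph_isoI:
  assumes wf: "wf_digraph (with_proj G)" and f: "bij_betw f (pverts G) (pverts H)"
    and a: "parcs H = map_prod f f ` parcs G"
  shows "digraph_iso (with_proj G) (with_proj H)"
proof -
  let ?h = "\<lparr>iso_verts = f, iso_arcs = map_prod f f, iso_head = snd, iso_tail = fst\<rparr>"
  have sub: "parcs G \<subseteq> pverts G \<times> pverts G"
    using wf unfolding wf_digraph_def by fastforce
  have inj: "inj_on f (pverts G)" using f by (simp add: bij_betw_def)
  have "inj_on (map_prod f f) (parcs G)"
    using map_prod_inj_on[OF inj inj] sub by (rule inj_on_subset)
  then have "pre_digraph.digraph_isomorphism (with_proj G) ?h"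
    using wf inj by (auto simp: pre_digraph.digraph_isomorphism_def)
  moreover have "with_proj H = app_iso ?h (with_proj G)"
    using f a by (simp add: app_iso_def with_proj_def bij_betw_def)
  ultimately show ?thesis unfolding digraph_iso_def by blast
qed

lemma graph_rel_refl: "pair_graph G \<Longrightarrow> graph_rel G G"
  unfolding graph_rel_def by (auto intro!: digraph_isoI[of _ id] pair_graph_wf simp: prod.map_id0)

lemma graph_rel_sym: "graph_rel G H \<Longrightarrow> graph_rel H G"
  unfolding graph_rel_def by (auto intro: digraph_iso_swap pair_graph_wf)

lemma graph_rel_trans: "graph_rel G H \<Longrightarrow> graph_rel H K \<Longrightarrow> graph_rel G K"
  unfolding graph_rel_def by (auto intro: digraph_iso_trans)

quotient_type graph_class = "nat pair_pre_digraph" / partial: graph_rel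
proof (rule part_equivpI)
  show "\<exists>G. graph_rel G G" using graph_rel_refl[OF pair_graph_empty] by blast
  show "symp graph_rel" by (auto intro: sympI graph_rel_sym)
  show "transp graph_rel" by (auto intro: transpI graph_rel_trans)
qed

lemma graph_relE:
  assumes "graph_rel G H"
  obtains f where "pair_graph G" "pair_graph H" "bij_betw f (pverts G) (pverts H)"
    "\<And>u v. u \<in> pverts G \<Longrightarrow> v \<in> pverts G \<Longrightarrow> (u, v) \<in> parcs G \<longleftrightarrow> (f u, f v) \<in> parcs H"
proof -
  from assms have G: "pair_graph G" and H: "pair_graph H"
    and "digraph_iso (with_proj G) (with_proj H)" by (auto simp: graph_rel_def)
  then obtain f where f: "bij_betw f (pverts G) (pverts H)" "parcs H = map_prod f f ` parcs G"
    by (auto elim: digraph_isoE)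
  have sub: "parcs G \<subseteq> pverts G \<times> pverts G"
    using pair_graph_wf[OF G] unfolding wf_digraph_def by fastforce
  have inj: "inj_on f (pverts G)" using f by (simp add: bij_betw_def)
  show ?thesis
  proof (rule that[OF G H f(1)])
    fix u v assume uv: "u \<in> pverts G" "v \<in> pverts G"
    show "(u, v) \<in> parcs G \<longleftrightarrow> (f u, f v) \<in> parcs H"
      unfolding f(2)
    proof
      assume "(f u, f v) \<in> map_prod f f ` parcs G"
      then obtain a b where ab: "(a, b) \<in> parcs G" "f u = f a" "f v = f b" by auto
      with sub uv inj have "u = a" "v = b" by (auto dest: inj_onD)
      with ab show "(u, v) \<in> parcs G" by simp
    qed force
  qed
qed

lift_definition num_verts :: "graph_class \<Rightarrow> nat" is "\<lambda>G. card (pverts G)"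
  by (auto elim!: graph_relE intro: bij_betw_same_card)

text \<open>\<^const>\<open>connected\<close> requires at least one vertex.\<close>

lift_definition connected_class :: "graph_class \<Rightarrow> bool" is "\<lambda>G. connected (with_proj G)"
proof -
  have *: "connected (with_proj H)" if r: "graph_rel G H" and c: "connected (with_proj G)" for G H
  proof -
    interpret wf_digraph "with_proj G" using r by (auto simp: graph_rel_def intro: pair_graph_wf)
    from r obtain h where "pre_digraph.digraph_isomorphism (with_proj G) h"
      and "with_proj H = app_iso h (with_proj G)"
      unfolding graph_rel_def digraph_iso_def by blast
    then show ?thesis using connectedI_app_iso[OF c, of h] by simp
  qed
  fix G H assume "graph_rel G H"
  then show "connected (with_proj G) = connected (with_proj H)"
    using * graph_rel_sym by blast
qed


section \<open>The functions $[H]$ and the space $\mathcal P$\<close>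

text \<open>Embeddings are made extensional outside the vertex set so that they can be counted.\<close>

definition embeddings :: "nat pair_pre_digraph \<Rightarrow> nat pair_pre_digraph \<Rightarrow> (nat \<Rightarrow> nat) set" where
  "embeddings H G = {f \<in> pverts H \<rightarrow>\<^sub>E pverts G. inj_on f (pverts H) \<and>
     (\<forall>u\<in>pverts H. \<forall>v\<in>pverts H. (u, v) \<in> parcs H \<longleftrightarrow> (f u, f v) \<in> parcs G)}"

definition automorphisms :: "nat pair_pre_digraph \<Rightarrow> (nat \<Rightarrow> nat) set" where
  "automorphisms H = {f \<in> embeddings H H. bij_betw f (pverts H) (pverts H)}"

lemma finite_embeddings: "pair_graph H \<Longrightarrow> pair_graph G \<Longrightarrow> finite (embeddings H G)"
  unfolding embeddings_def by (auto intro!: finite_PiE pair_graph_finite)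

lemma transport_embeddings:
  assumes H: "graph_rel H H'" and G: "graph_rel G G'"
  obtains T where "inj_on T (embeddings H G)" "T ` embeddings H G \<subseteq> embeddings H' G'"
    and "\<And>e. e \<in> embeddings H G \<Longrightarrow> bij_betw e (pverts H) (pverts G) \<Longrightarrow>
      bij_betw (T e) (pverts H') (pverts G')"
proof -
  from graph_rel_sym[OF H] obtain f where f: "bij_betw f (pverts H') (pverts H)"
    and fe: "\<And>u v. u \<in> pverts H' \<Longrightarrow> v \<in> pverts H' \<Longrightarrow> (u, v) \<in> parcs H' \<longleftrightarrow> (f u, f v) \<in> parcs H"
    by (auto elim: graph_relE)
  from G obtain g where g: "bij_betw g (pverts G) (pverts G')"
    and ge: "\<And>u v. u \<in> pverts G \<Longrightarrow> v \<in> pverts G \<Longrightarrow> (u, v) \<in> parcs G \<longleftrightarrow> (g u, g v) \<in> parcs G'"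
    by (auto elim: graph_relE)
  define T where "T e = restrict (g \<circ> e \<circ> f) (pverts H')" for e :: "nat \<Rightarrow> nat"
  have fm: "f u \<in> pverts H" if "u \<in> pverts H'" for u using f that by (auto simp: bij_betw_def)
  have gm: "g u \<in> pverts G'" if "u \<in> pverts G" for u using g that by (auto simp: bij_betw_def)
  show ?thesis
  proof
    show "inj_on T (embeddings H G)"
    proof (rule inj_onI)
      fix d e assume d: "d \<in> embeddings H G" and e: "e \<in> embeddings H G" and eq: "T d = T e"
      have "d x = e x" if "x \<in> pverts H" for x
      proof -
        from that f obtain y where y: "y \<in> pverts H'" "x = f y" by (auto simp: bij_betw_def)
        have "g (d x) = g (e x)" using fun_cong[OF eq, of y] y by (simp add: T_def)
        moreover have "d x \<in> pverts G" "e x \<in> pverts G"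
          using d e that by (auto simp: embeddings_def)
        ultimately show ?thesis using g by (auto simp: bij_betw_def dest: inj_onD)
      qed
      then show "d = e" using d e
        by (auto simp: embeddings_def intro: PiE_ext)
    qed
    show "T ` embeddings H G \<subseteq> embeddings H' G'"
    proof safe
      fix e assume e: "e \<in> embeddings H G"
      have em: "e u \<in> pverts G" if "u \<in> pverts H" for u using e that by (auto simp: embeddings_def)
      have ei: "inj_on e (pverts H)" using e by (auto simp: embeddings_def)
      have "inj_on (T e) (pverts H')"
      proof (rule inj_onI)
        fix u v assume uv: "u \<in> pverts H'" "v \<in> pverts H'" "T e u = T e v"
        then have "g (e (f u)) = g (e (f v))" by (simp add: T_def)
        then have "e (f u) = e (f v)" using g em fm uv by (auto simp: bij_betw_def dest: inj_onD)
        then have "f u = f v" using ei fm uv by (auto dest: inj_onD)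
        then show "u = v" using f uv by (auto simp: bij_betw_def dest: inj_onD)
      qed
      moreover have "(u, v) \<in> parcs H' \<longleftrightarrow> (T e u, T e v) \<in> parcs G'"
        if "u \<in> pverts H'" "v \<in> pverts H'" for u v
      proof -
        have "(u, v) \<in> parcs H' \<longleftrightarrow> (f u, f v) \<in> parcs H" using that by (rule fe)
        also have "\<dots> \<longleftrightarrow> (e (f u), e (f v)) \<in> parcs G"
          using e fm that unfolding embeddings_def by blast
        also have "\<dots> \<longleftrightarrow> (g (e (f u)), g (e (f v))) \<in> parcs G'"
          using em fm that by (intro ge) auto
        finally show ?thesis using that by (simp add: T_def)
      qed
      ultimately show "T e \<in> embeddings H' G'"
        using fm gm em by (auto simp: embeddings_def T_def)
    qed
  next
    fix e assume "e \<in> embeddings H G" "bij_betw e (pverts H) (pverts G)"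
    with f g have "bij_betw (g \<circ> e \<circ> f) (pverts H') (pverts G')"
      by (metis bij_betw_trans)
    then show "bij_betw (T e) (pverts H') (pverts G')"
      by (subst bij_betw_cong[where g = "g \<circ> e \<circ> f"]) (auto simp: T_def)
  qed
qed

lemma card_embeddings_cong:
  assumes "graph_rel H H'" "graph_rel G G'"
  shows "card (embeddings H G) = card (embeddings H' G')"
proof -
  have *: "card (embeddings H G) \<le> card (embeddings H' G')"
    if H: "graph_rel H H'" and G: "graph_rel G G'" for H H' G G'
  proof -
    have "finite (embeddings H' G')"
      using H G by (auto simp: graph_rel_def intro: finite_embeddings)
    moreover obtain T where "inj_on T (embeddings H G)" "T ` embeddings H G \<subseteq> embeddings H' G'"
      by (rule transport_embeddings[OF H G])
    ultimately show ?thesis by (auto intro: card_inj_on_le)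
  qed
  show ?thesis
    using *[OF assms] *[OF assms[THEN graph_rel_sym]] by simp
qed

lemma card_automorphisms_cong:
  assumes "graph_rel H H'"
  shows "card (automorphisms H) = card (automorphisms H')"
proof -
  have *: "card (automorphisms H) \<le> card (automorphisms H')" if H: "graph_rel H H'" for H H'
  proof -
    have fin: "finite (automorphisms H')"
      using H finite_embeddings[of H' H'] by (auto simp: graph_rel_def automorphisms_def)
    from transport_embeddings[OF H H] obtain T where T: "inj_on T (embeddings H H)"
      "T ` embeddings H H \<subseteq> embeddings H' H'"
      "\<And>e. e \<in> embeddings H H \<Longrightarrow> bij_betw e (pverts H) (pverts H) \<Longrightarrow>
        bij_betw (T e) (pverts H') (pverts H')"
      by blast
    have "inj_on T (automorphisms H)"
      using T(1) by (rule inj_on_subset) (auto simp: automorphisms_def)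
    moreover have "T ` automorphisms H \<subseteq> automorphisms H'"
      using T(2,3) by (auto simp: automorphisms_def)
    ultimately show ?thesis using fin by (rule card_inj_on_le)
  qed
  show ?thesis
    using *[OF assms] *[OF assms[THEN graph_rel_sym]] by simp
qed

text \<open>
  The number $i(H,G)$, as a rational number; for fixed $H$, the function
  \<open>ind_count H\<close> is the element $[H]$ of the space of functions $\mathcal G \to \mathbb Q$.
\<close>

lift_definition ind_count :: "graph_class \<Rightarrow> graph_class \<Rightarrow> rat" is
  "\<lambda>H G. of_nat (card (embeddings H G)) / of_nat (card (automorphisms H))"
  using card_embeddings_cong card_automorphisms_cong by simp

definition fun_scale :: "rat \<Rightarrow> ('a \<Rightarrow> rat) \<Rightarrow> 'a \<Rightarrow> rat" where
  "fun_scale c f = (\<lambda>x. c * f x)"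

global_interpretation rat_fun: vector_space fun_scale
  by unfold_locales (auto simp: fun_scale_def algebra_simps)

definition P_space :: "(graph_class \<Rightarrow> rat) set" where
  "P_space = rat_fun.span (range ind_count)"


section \<open>The coefficients $c_H$\<close>

definition covering_pairs ::
  "nat pair_pre_digraph \<Rightarrow> nat pair_pre_digraph \<Rightarrow> nat pair_pre_digraph \<Rightarrow>
    (nat pair_pre_digraph \<times> nat pair_pre_digraph) set" where
  "covering_pairs H1 H2 H = {(F1, F2).
     induced_subgraph (with_proj F1) (with_proj H) \<and> induced_subgraph (with_proj F2) (with_proj H) \<and>
     digraph_iso (with_proj F1) (with_proj H1) \<and> digraph_iso (with_proj F2) (with_proj H2) \<and>
     pverts F1 \<union> pverts F2 = pverts H}"

lemma finite_covering_pairs: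
  assumes "pair_graph H"
  shows "finite (covering_pairs H1 H2 H)"
proof -
  let ?S = "(\<lambda>(V, A). \<lparr>pverts = V, parcs = A\<rparr>) ` (Pow (pverts H) \<times> Pow (parcs H))"
  have "F \<in> ?S" if "induced_subgraph (with_proj F) (with_proj H)" for F
    using that by (cases F) (auto simp: induced_subgraph_def subgraph_def)
  then have "covering_pairs H1 H2 H \<subseteq> ?S \<times> ?S" by (auto simp: covering_pairs_def)
  moreover have "finite ?S"
    using assms by (auto intro: pair_graph_finite pair_graph_finite_arcs)
  ultimately show ?thesis by (meson finite_SigmaI finite_subset)
qed

lemma card_covering_pairs_le:
  assumes 1: "graph_rel H1 H1'" and 2: "graph_rel H2 H2'" and H: "graph_rel H H'"
  shows "card (covering_pairs H1 H2 H) \<le> card (covering_pairs H1' H2' H')"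
proof -
  from H obtain f where pg: "pair_graph H" "pair_graph H'"
    and f: "bij_betw f (pverts H) (pverts H')"
    and fe: "\<And>u v. u \<in> pverts H \<Longrightarrow> v \<in> pverts H \<Longrightarrow> (u, v) \<in> parcs H \<longleftrightarrow> (f u, f v) \<in> parcs H'"
    by (auto elim: graph_relE)
  have finj: "inj_on f (pverts H)" using f by (simp add: bij_betw_def)
  define p where "p F = \<lparr>pverts = f ` pverts F, parcs = map_prod f f ` parcs F\<rparr>"
    for F :: "nat pair_pre_digraph"
  have F: "pverts F \<subseteq> pverts H" "parcs F = parcs H \<inter> pverts F \<times> pverts F"
    "wf_digraph (with_proj F)"
    if "induced_subgraph (with_proj F) (with_proj H)" for F
    using that by (auto simp: induced_subgraph_def subgraph_def)
  have pind: "induced_subgraph (with_proj (p F)) (with_proj H')"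
    if ind: "induced_subgraph (with_proj F) (with_proj H)" for F
  proof -
    have V: "f ` pverts F \<subseteq> pverts H'" using F(1)[OF ind] f by (auto simp: bij_betw_def)
    have A: "parcs (p F) = {e \<in> parcs H'. fst e \<in> f ` pverts F \<and> snd e \<in> f ` pverts F}"
    proof (intro subset_antisym subsetI)
      fix e assume "e \<in> parcs (p F)"
      then obtain u v where "(u, v) \<in> parcs F" "e = (f u, f v)" by (auto simp: p_def)
      moreover from this have "(u, v) \<in> parcs H" "u \<in> pverts F" "v \<in> pverts F"
        using F(2)[OF ind] by auto
      ultimately show "e \<in> {e \<in> parcs H'. fst e \<in> f ` pverts F \<and> snd e \<in> f ` pverts F}"
        using fe[of u v] F(1)[OF ind] by auto
    next
      fix e assume "e \<in> {e \<in> parcs H'. fst e \<in> f ` pverts F \<and> snd e \<in> f ` pverts F}"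
      then obtain u v where uv: "u \<in> pverts F" "v \<in> pverts F" "e = (f u, f v)" "e \<in> parcs H'"
        by (cases e) auto
      then have "(u, v) \<in> parcs F" using fe[of u v] F(1,2)[OF ind] by auto
      then show "e \<in> parcs (p F)" using uv(3) by (force simp: p_def)
    qed
    show ?thesis
      unfolding induced_subgraph_def subgraph_def compatible_def
      using V A pair_graph_wf[OF pg(2)] by (simp add: wf_digraph_def) (auto simp: p_def)
  qed
  have piso: "digraph_iso (with_proj (p F)) (with_proj K)"
    if ind: "induced_subgraph (with_proj F) (with_proj H)"
      and K: "digraph_iso (with_proj F) (with_proj K0)" "graph_rel K0 K" for F K0 K
  proof -
    have "digraph_iso (with_proj F) (with_proj (p F))"
      using F[OF ind] finj
      by (intro digraph_isoI[of _ f]) (auto simp: p_def bij_betw_def intro: inj_on_subset)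
    then have "digraph_iso (with_proj (p F)) (with_proj F)"
      using F(3)[OF ind] by (rule digraph_iso_swap[rotated])
    then show ?thesis using K by (auto simp: graph_rel_def intro: digraph_iso_trans)
  qed
  have inj: "F = F'" if ind: "induced_subgraph (with_proj F) (with_proj H)"
    "induced_subgraph (with_proj F') (with_proj H)" and eq: "p F = p F'" for F F'
  proof -
    have "f ` pverts F = f ` pverts F'" using arg_cong[OF eq, of pverts] by (simp add: p_def)
    then have "pverts F = pverts F'"
      using inj_on_image_eq_iff[OF finj F(1)[OF ind(1)] F(1)[OF ind(2)]] by simp
    moreover from this have "parcs F = parcs F'" using F(2)[OF ind(1)] F(2)[OF ind(2)] by simp
    ultimately show ?thesis by simp
  qed
  have "inj_on (map_prod p p) (covering_pairs H1 H2 H)"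
    by (rule inj_onI) (auto simp: covering_pairs_def intro: inj)
  moreover have "map_prod p p ` covering_pairs H1 H2 H \<subseteq> covering_pairs H1' H2' H'"
  proof (rule image_subsetI)
    fix x assume "x \<in> covering_pairs H1 H2 H"
    then obtain F1 F2 where x: "x = (F1, F2)" and c: "(F1, F2) \<in> covering_pairs H1 H2 H"
      by (cases x) auto
    have "pverts (p F1) \<union> pverts (p F2) = f ` (pverts F1 \<union> pverts F2)" by (auto simp: p_def)
    also have "\<dots> = pverts H'" using c f by (simp add: covering_pairs_def bij_betw_def)
    finally show "map_prod p p x \<in> covering_pairs H1' H2' H'"
      using x c pind piso[OF _ _ 1] piso[OF _ _ 2] by (auto simp: covering_pairs_def)
  qed
  ultimately show ?thesis
    using finite_covering_pairs[OF pg(2)] by (rule card_inj_on_le)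
qed

lift_definition prod_coeff :: "graph_class \<Rightarrow> graph_class \<Rightarrow> graph_class \<Rightarrow> nat" is
  "\<lambda>H1 H2 H. card (covering_pairs H1 H2 H)"
  by (meson antisym card_covering_pairs_le graph_rel_sym)


section \<open>Algebras over the rationals\<close>

definition rat_ring :: "rat ring" where
  "rat_ring = \<lparr>carrier = UNIV, monoid.mult = (*), one = 1, zero = 0, add = (+)\<rparr>"

text \<open>\<open>P_space\<close> with the pointwise operations.\<close>

definition P_alg :: "(rat, graph_class \<Rightarrow> rat) module" where
  "P_alg = \<lparr>carrier = P_space, monoid.mult = (*), one = 1, zero = 0, add = (+), smult = fun_scale\<rparr>"

text \<open>
  Monomials in the variables \<open>'v\<close> are the finitely supported exponent functions \<^typ>\<open>'v \<Rightarrow>\<^sub>0 nat\<close>,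
  multiplied by adding exponents, and \<^typ>\<open>('v \<Rightarrow>\<^sub>0 nat) \<Rightarrow>\<^sub>0 rat\<close> carries the convolution product.
  So \<open>mpoly_alg V\<close> is the polynomial algebra on the set \<open>V\<close>.
\<close>

definition mpoly_alg :: "'v set \<Rightarrow> (rat, ('v \<Rightarrow>\<^sub>0 nat) \<Rightarrow>\<^sub>0 rat) module" where
  "mpoly_alg V = \<lparr>carrier = {p. \<forall>m\<in>Poly_Mapping.keys p. Poly_Mapping.keys m \<subseteq> V},
     monoid.mult = (*), one = 1, zero = 0, add = (+), smult = (\<lambda>c. Poly_Mapping.map ((*) c))\<rparr>"

definition mpoly_var :: "'v \<Rightarrow> ('v \<Rightarrow>\<^sub>0 nat) \<Rightarrow>\<^sub>0 rat" where
  "mpoly_var v = Poly_Mapping.single (Poly_Mapping.single v 1) 1"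

definition rat_alg_hom :: "(rat, 'a) module \<Rightarrow> (rat, 'b) module \<Rightarrow> ('a \<Rightarrow> 'b) set" where
  "rat_alg_hom A B = {\<phi> \<in> ring_hom A B.
     \<forall>c. \<forall>x\<in>carrier A. \<phi> (c \<odot>\<^bsub>A\<^esub> x) = c \<odot>\<^bsub>B\<^esub> \<phi> x}"

definition rat_subalgebra :: "('a \<Rightarrow> rat) set \<Rightarrow> bool" where
  "rat_subalgebra S \<longleftrightarrow> rat_fun.subspace S \<and> 1 \<in> S \<and> (\<forall>f\<in>S. \<forall>g\<in>S. f * g \<in> S)"

definition connected_funs :: "(graph_class \<Rightarrow> rat) set" where
  "connected_funs = ind_count ` {H. connected_class H}"

end

theory Submission
  imports Defs
begin

text \<open>
  The number \<open>i(H,G)\<close> counts the vertex sets \<open>S\<close> with \<open>G[S]\<close> isomorphic to \<open>H\<close>, so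
  \<open>[H\<^sub>1][H\<^sub>2](G)\<close> counts pairs \<open>(S\<^sub>1, S\<^sub>2)\<close>; sorting these by their union gives the product
  formula. For generation, let \<open>H\<close> be the disjoint union of nonempty graphs \<open>A\<close> and \<open>B\<close>. In
  the product \<open>[A][B]\<close> the coefficient of \<open>[H]\<close> is positive, and every other graph that occurs
  has fewer vertices than \<open>H\<close>, or as many vertices and more edges, since it arises from \<open>H\<close> by
  adding edges between \<open>A\<close> and \<open>B\<close>. So \<open>[H]\<close> can be solved for by induction.
\<close>

section \<open>Copies of a graph inside another one\<close>

text \<open>Replaces the locale hierarchy by elementary conditions that automation can check on
  explicitly built graphs. Finiteness of the arc set follows from that of the vertex set.\<close>

lemma pair_graph_iff:
  "pair_graph G \<longleftrightarrow> finite (pverts G) \<and> parcs G \<subseteq> pverts G \<times> pverts G \<and>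
     (\<forall>u v. (u, v) \<in> parcs G \<longrightarrow> (v, u) \<in> parcs G \<and> u \<noteq> v)"
  (is "_ \<longleftrightarrow> ?R")
proof
  assume G: "pair_graph G"
  then interpret pair_graph G .
  have "(v, u) \<in> parcs G \<and> u \<noteq> v" if "(u, v) \<in> parcs G" for u v
    using that pair_sym_arcs pair_no_loops[of "(u, v)"] by (auto simp: symmetric_def elim: symE)
  moreover have "parcs G \<subseteq> pverts G \<times> pverts G"
    using arc_fst_in_verts arc_snd_in_verts by fastforce
  ultimately show ?R using pair_finite_verts by simp
next
  assume ?R
  then have *: "finite (pverts G)" "parcs G \<subseteq> pverts G \<times> pverts G"
    "\<And>u v. (u, v) \<in> parcs G \<Longrightarrow> (v, u) \<in> parcs G" "\<And>u v. (u, v) \<in> parcs G \<Longrightarrow> u \<noteq> v" by blast+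
  then have "finite (parcs G)" by (meson finite_SigmaI finite_subset)
  with * show "pair_graph G"
    by unfold_locales (auto simp: symmetric_def sym_def)
qed

lemma pair_graph_arcsD:
  assumes "pair_graph G" "(u, v) \<in> parcs G"
  shows "u \<in> pverts G" "v \<in> pverts G" "(v, u) \<in> parcs G" "u \<noteq> v"
  using assms by (auto simp: pair_graph_iff)

text \<open>Converse of \<open>graph_relE\<close>: a bijection that preserves and reflects arcs also
  maps onto the arc set, because both ends of each arc of \<open>H\<close> lie in its image.
  Isomorphisms thus take the same form as \<open>embeddings\<close>.\<close>

lemma graph_rel_iff:
  "graph_rel G H \<longleftrightarrow> pair_graph G \<and> pair_graph H \<and> (\<exists>f. bij_betw f (pverts G) (pverts H) \<and>
     (\<forall>u\<in>pverts G. \<forall>v\<in>pverts G. (u, v) \<in> parcs G \<longleftrightarrow> (f u, f v) \<in> parcs H))"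
proof (intro iffI; (elim conjE exE)?)
  assume "graph_rel G H"
  then obtain f where f: "pair_graph G" "pair_graph H" "bij_betw f (pverts G) (pverts H)"
    "\<And>u v. u \<in> pverts G \<Longrightarrow> v \<in> pverts G \<Longrightarrow> (u, v) \<in> parcs G \<longleftrightarrow> (f u, f v) \<in> parcs H"
    by (auto elim: graph_relE)
  then show "pair_graph G \<and> pair_graph H \<and> (\<exists>f. bij_betw f (pverts G) (pverts H) \<and>
     (\<forall>u\<in>pverts G. \<forall>v\<in>pverts G. (u, v) \<in> parcs G \<longleftrightarrow> (f u, f v) \<in> parcs H))"
    by blast
next
  fix f assume G: "pair_graph G" and H: "pair_graph H" and f: "bij_betw f (pverts G) (pverts H)"
    and e: "\<forall>u\<in>pverts G. \<forall>v\<in>pverts G. (u, v) \<in> parcs G \<longleftrightarrow> (f u, f v) \<in> parcs H"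
  have "parcs H = map_prod f f ` parcs G"
  proof (intro subset_antisym subsetI)
    fix a assume a: "a \<in> parcs H"
    then have "fst a \<in> f ` pverts G" "snd a \<in> f ` pverts G"
      using f pair_graph_arcsD(1,2)[OF H, of "fst a" "snd a"] by (auto simp: bij_betw_def)
    then obtain u v where "u \<in> pverts G" "v \<in> pverts G" "a = (f u, f v)"
      by (metis imageE surjective_pairing)
    then show "a \<in> map_prod f f ` parcs G" using e a by force
  next
    fix a assume "a \<in> map_prod f f ` parcs G"
    then show "a \<in> parcs H" using e by (auto dest: pair_graph_arcsD(1,2)[OF G])
  qed
  then show "graph_rel G H"
    unfolding graph_rel_def using G H f by (auto intro: digraph_isoI pair_graph_wf)
qed

lemma graph_rel_refl_iff: "graph_rel G G \<longleftrightarrow> pair_graph G"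
  using graph_rel_refl by (auto simp: graph_rel_def)

lemma abs_graph_class_eq_iff:
  assumes "pair_graph G" "pair_graph H"
  shows "abs_graph_class G = abs_graph_class H \<longleftrightarrow> graph_rel G H"
  using Quotient3_rel[OF Quotient3_graph_class, of G H] assms by (simp add: graph_rel_refl_iff)

lemma graph_class_cases:
  obtains G where "pair_graph G" "C = abs_graph_class G"
  by (induction C rule: graph_class.abs_induct) (auto simp: graph_rel_refl_iff)

text \<open>Intersecting with the vertex set makes the operation meaningful for every
  \<open>S\<close>, so that \<open>induced_induced\<close> holds unconditionally.\<close>

definition induced :: "'a pair_pre_digraph \<Rightarrow> 'a set \<Rightarrow> 'a pair_pre_digraph" where
  "induced G S = \<lparr>pverts = S \<inter> pverts G, parcs = parcs G \<inter> S \<times> S\<rparr>"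

lemma pverts_induced [simp]: "pverts (induced G S) = S \<inter> pverts G"
  and parcs_induced [simp]: "parcs (induced G S) = parcs G \<inter> S \<times> S"
  by (simp_all add: induced_def)

lemma induced_induced [simp]: "induced (induced G S) T = induced G (S \<inter> T)"
  by (auto simp: induced_def)

lemma pair_graph_induced: "pair_graph G \<Longrightarrow> pair_graph (induced G S)"
  by (auto simp: pair_graph_iff)

lemma induced_subgraph_iff:
  assumes "pair_graph G"
  shows "induced_subgraph (with_proj F) (with_proj G) \<longleftrightarrow>
    pverts F \<subseteq> pverts G \<and> F = induced G (pverts F)"
proof safe
  assume F: "induced_subgraph (with_proj F) (with_proj G)"
  then show "x \<in> pverts G" if "x \<in> pverts F" for x
    using that by (auto simp: induced_subgraph_def subgraph_def)
  then show "F = induced G (pverts F)"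
    using F by (cases F) (auto simp: induced_def induced_subgraph_def)
next
  assume sub: "pverts F \<subseteq> pverts G" and F: "F = induced G (pverts F)"
  have arcs: "parcs F = parcs G \<inter> pverts F \<times> pverts F"
    using arg_cong[OF F, of parcs] by simp
  have "pair_graph F" using pair_graph_induced[OF assms, of "pverts F"] F by simp
  then show "induced_subgraph (with_proj F) (with_proj G)"
    using sub arcs assms
    by (auto simp: induced_subgraph_def subgraph_def compatible_def intro: pair_graph_wf)
qed

text \<open>The subsets counted by the second description of \<open>i(H,G)\<close>. The index is a
  class, so no representative of it has to be chosen.\<close>

definition copies :: "graph_class \<Rightarrow> nat pair_pre_digraph \<Rightarrow> nat set set" where
  "copies C G = {S. S \<subseteq> pverts G \<and> abs_graph_class (induced G S) = C}"

lemma finite_copies: "pair_graph G \<Longrightarrow> finite (copies C G)"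
  by (rule finite_subset[of _ "Pow (pverts G)"]) (auto simp: copies_def pair_graph_finite)

lemma num_verts_abs: "pair_graph G \<Longrightarrow> num_verts (abs_graph_class G) = card (pverts G)"
  by (simp add: num_verts.abs_eq graph_rel_refl_iff)

lemma card_copy:
  assumes "pair_graph G" "S \<in> copies C G"
  shows "card S = num_verts C"
  using assms num_verts_abs[OF pair_graph_induced[OF assms(1)], of S]
  by (auto simp: copies_def Int_absorb2)

text \<open>Transport along the isomorphism, with \<open>H\<close> kept fixed, injects surjective
  embeddings in both directions.\<close>

lemma card_bij_embeddings:
  assumes H: "pair_graph H" and r: "graph_rel H G"
  shows "card {f \<in> embeddings H G. bij_betw f (pverts H) (pverts G)} = card (automorphisms H)"
proof -
  have le: "card {f \<in> embeddings H A. bij_betw f (pverts H) (pverts A)} \<le>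
      card {f \<in> embeddings H B. bij_betw f (pverts H) (pverts B)}"
    if AB: "graph_rel A B" for A B
  proof -
    obtain T where T: "inj_on T (embeddings H A)" "T ` embeddings H A \<subseteq> embeddings H B"
      "\<And>e. e \<in> embeddings H A \<Longrightarrow> bij_betw e (pverts H) (pverts A) \<Longrightarrow>
        bij_betw (T e) (pverts H) (pverts B)"
      using transport_embeddings[OF graph_rel_refl[OF H] AB] by metis
    show ?thesis
    proof (rule card_inj_on_le)
      show "inj_on T {f \<in> embeddings H A. bij_betw f (pverts H) (pverts A)}"
        using T(1) by (rule inj_on_subset) auto
      show "finite {f \<in> embeddings H B. bij_betw f (pverts H) (pverts B)}"
        using finite_embeddings[OF H, of B] AB by (simp add: graph_rel_def)
    qed (use T in auto)
  qed
  show ?thesis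
    using le[OF r] le[OF graph_rel_sym[OF r]] by (simp add: automorphisms_def)
qed

text \<open>The arc condition on \<open>f\<close> only sees arcs inside its image. Hence the fibre
  over \<open>S\<close> of the map from embeddings to images consists of the isomorphisms onto
  \<open>G[S]\<close>.\<close>

lemma bij_embeddings_induced:
  assumes "S \<subseteq> pverts G"
  shows "{f \<in> embeddings H (induced G S). bij_betw f (pverts H) (pverts (induced G S))} =
    {f \<in> embeddings H G. f ` pverts H = S}"
proof -
  have "f \<in> embeddings H (induced G S) \<longleftrightarrow> f \<in> embeddings H G" if "f ` pverts H = S" for f
    using that assms by (auto simp: embeddings_def PiE_iff)
  then show ?thesis
    using assms by (auto simp: bij_betw_def Int_absorb2 embeddings_def[of H G])
qed

lemma embedding_image_copy:
  assumes H: "pair_graph H" and G: "pair_graph G" and f: "f \<in> embeddings H G"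
  shows "f ` pverts H \<in> copies (abs_graph_class H) G"
proof -
  have sub: "f ` pverts H \<subseteq> pverts G" using f by (auto simp: embeddings_def)
  have "graph_rel H (induced G (f ` pverts H))"
    unfolding graph_rel_iff
    using f sub pair_graph_induced[OF G] H
    by (auto intro!: exI[of _ f] simp: embeddings_def bij_betw_def Int_absorb2)
  then show ?thesis
    using sub abs_graph_class_eq_iff[OF H pair_graph_induced[OF G]]
    by (metis (mono_tags, lifting) copies_def mem_Collect_eq)
qed

lemma automorphisms_nonempty:
  assumes "pair_graph H"
  shows "card (automorphisms H) > 0"
proof -
  have "restrict id (pverts H) \<in> automorphisms H"
    by (auto simp: automorphisms_def embeddings_def bij_betw_def inj_on_def)
  moreover have "finite (automorphisms H)"
    using finite_embeddings[OF assms assms] by (simp add: automorphisms_def)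
  ultimately show ?thesis by (auto simp: card_gt_0_iff)
qed

text \<open>Embeddings are sorted by their image: the images are exactly the copies, and every fibre
  has as many elements as there are automorphisms of \<open>H\<close>.\<close>

theorem ind_count_eq_card_copies:
  assumes G: "pair_graph G"
  shows "ind_count C (abs_graph_class G) = of_nat (card (copies C G))"
proof -
  obtain H where H: "pair_graph H" and C: "C = abs_graph_class H"
    using graph_class_cases by metis
  let ?E = "\<lambda>S. {f \<in> embeddings H G. f ` pverts H = S}"
  have E: "card (?E S) = card (automorphisms H)" if S: "S \<in> copies C G" for S
  proof -
    have "graph_rel H (induced G S)"
      using S abs_graph_class_eq_iff[OF H pair_graph_induced[OF G], of S]
      by (simp add: copies_def C eq_commute[of "abs_graph_class H"])
    from card_bij_embeddings[OF H this] show ?thesis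
      using S by (subst (asm) bij_embeddings_induced) (auto simp: copies_def)
  qed
  have "embeddings H G = (\<Union>S\<in>copies C G. ?E S)"
    using embedding_image_copy[OF H G] by (auto simp: C)
  also have "card \<dots> = (\<Sum>S\<in>copies C G. card (?E S))"
    using finite_copies[OF G] finite_embeddings[OF H G] by (intro card_UN_disjoint) auto
  also have "\<dots> = card (copies C G) * card (automorphisms H)" using E by simp
  finally have "card (embeddings H G) = card (copies C G) * card (automorphisms H)" .
  then show ?thesis
    using automorphisms_nonempty[OF H] H G
    by (simp add: C ind_count.abs_eq graph_rel_refl_iff)
qed

text \<open>An induced subgraph is determined by its vertex set, so covering pairs of subgraphs
  correspond bijectively to pairs of copies that cover the vertices.\<close>

lemma prod_coeff_eq_card:
  assumes G: "pair_graph G"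
  shows "prod_coeff C1 C2 (abs_graph_class G) =
    card {(S, T). S \<in> copies C1 G \<and> T \<in> copies C2 G \<and> S \<union> T = pverts G}"
    (is "_ = card ?A")
proof -
  obtain H1 where H1: "pair_graph H1" "C1 = abs_graph_class H1" using graph_class_cases by metis
  obtain H2 where H2: "pair_graph H2" "C2 = abs_graph_class H2" using graph_class_cases by metis
  have iso: "digraph_iso (with_proj (induced G S)) (with_proj H) \<longleftrightarrow>
      abs_graph_class (induced G S) = abs_graph_class H" if "pair_graph H" for S H
    using that pair_graph_induced[OF G] by (simp add: abs_graph_class_eq_iff graph_rel_def)
  have "covering_pairs H1 H2 G = (\<lambda>(S, T). (induced G S, induced G T)) ` ?A"
  proof (intro subset_antisym subsetI)
    fix x assume x: "x \<in> covering_pairs H1 H2 G"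
    obtain F1 F2 where F: "x = (F1, F2)" by (cases x)
    from x have ind: "induced G (pverts F1) = F1" "induced G (pverts F2) = F2"
      by (auto simp: F covering_pairs_def induced_subgraph_iff[OF G])
    have "(pverts F1, pverts F2) \<in> ?A"
      using x iso[OF H1(1), of "pverts F1"] iso[OF H2(1), of "pverts F2"]
      by (auto simp: ind F covering_pairs_def induced_subgraph_iff[OF G] copies_def H1(2) H2(2))
    moreover have "x = (\<lambda>(S, T). (induced G S, induced G T)) (pverts F1, pverts F2)"
      using ind F by simp
    ultimately show "x \<in> (\<lambda>(S, T). (induced G S, induced G T)) ` ?A" by (rule rev_image_eqI)
  next
    fix x assume "x \<in> (\<lambda>(S, T). (induced G S, induced G T)) ` ?A"
    then show "x \<in> covering_pairs H1 H2 G"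
      using iso[OF H1(1)] iso[OF H2(1)]
      by (auto simp: covering_pairs_def induced_subgraph_iff[OF G] copies_def H1(2) H2(2)
          Int_absorb2)
  qed
  moreover have "inj_on (\<lambda>(S, T). (induced G S, induced G T)) ?A"
  proof (rule inj_onI; clarify)
    fix S T S' T'
    assume "S \<in> copies C1 G" "T \<in> copies C2 G" "S' \<in> copies C1 G" "T' \<in> copies C2 G"
      and "induced G S = induced G S'" "induced G T = induced G T'"
    then show "S = S' \<and> T = T'"
      by (metis (no_types, lifting) Int_absorb2 copies_def mem_Collect_eq pverts_induced)
  qed
  ultimately show ?thesis
    using H1 H2 G by (simp add: prod_coeff.abs_eq graph_rel_refl_iff card_image)
qed

section \<open>The product formula\<close>

lemma copies_induced:
  assumes "S \<subseteq> pverts G"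
  shows "copies C (induced G S) = {T \<in> copies C G. T \<subseteq> S}"
  using assms by (auto simp: copies_def Int_absorb1)

text \<open>Copies have fixed sizes, and their union is the whole vertex set. This is what confines
  the product formula to a finite range.\<close>

lemma num_verts_le_if_prod_coeff:
  assumes "prod_coeff C1 C2 C \<noteq> 0"
  shows "num_verts C \<le> num_verts C1 + num_verts C2"
proof -
  obtain G where G: "pair_graph G" "C = abs_graph_class G" using graph_class_cases by metis
  have "{(S, T). S \<in> copies C1 G \<and> T \<in> copies C2 G \<and> S \<union> T = pverts G} \<noteq> {}"
    using assms unfolding G(2) prod_coeff_eq_card[OF G(1)] by (metis card.empty)
  then obtain S T where "S \<in> copies C1 G" "T \<in> copies C2 G" "S \<union> T = pverts G" by auto
  then show ?thesis
    using card_Un_le[of S T] by (simp add: G num_verts_abs card_copy[OF G(1)])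
qed

text \<open>Each such class has a representative on an initial segment of the naturals. Finiteness
  is essential to the product formula, since a sum over an infinite set is 0 by convention.\<close>

lemma finite_num_verts_le: "finite {C. num_verts C \<le> n}"
proof (rule finite_subset)
  \<comment> \<open>All vertex and arc sets within \<open>{..<n}\<close>, including records that are
    not graphs; what matters is that this set is finite and contains the representatives.\<close>
  let ?R = "(\<lambda>(V, A). \<lparr>pverts = V, parcs = A\<rparr>) ` (Pow {..<n} \<times> Pow ({..<n} \<times> {..<n}))"
  show "finite (abs_graph_class ` ?R)" by simp
  show "{C. num_verts C \<le> n} \<subseteq> abs_graph_class ` ?R"
  proof
    fix C assume "C \<in> {C. num_verts C \<le> n}"
    moreover obtain G where G: "pair_graph G" "C = abs_graph_class G"
      using graph_class_cases by metis
    ultimately have n: "card (pverts G) \<le> n" by (simp add: num_verts_abs)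
    obtain f where f: "bij_betw f (pverts G) {..<card (pverts G)}"
      using ex_bij_betw_finite_nat[OF pair_graph_finite[OF G(1)]] by (auto simp: atLeast0LessThan)
    define H where "H = \<lparr>pverts = f ` pverts G, parcs = map_prod f f ` parcs G\<rparr>"
    have "digraph_iso (with_proj G) (with_proj H)"
      using f G(1) by (intro digraph_isoI[of _ f]) (auto simp: H_def bij_betw_def pair_graph_wf)
    moreover have "pair_graph H"
    proof -
      have "f u \<noteq> f v" if "(u, v) \<in> parcs G" for u v
        using f pair_graph_arcsD[OF G(1) that] by (auto simp: bij_betw_def inj_on_eq_iff)
      then show ?thesis
        using G(1) unfolding H_def pair_graph_iff by fastforce
    qed
    ultimately have "C = abs_graph_class H"
      using G by (simp add: abs_graph_class_eq_iff graph_rel_def)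
    moreover have "H \<in> ?R"
    proof -
      have "f ` pverts G \<subseteq> {..<n}" using f n by (auto simp: bij_betw_def)
      moreover from this have "map_prod f f ` parcs G \<subseteq> {..<n} \<times> {..<n}"
        using G(1) by (auto simp: pair_graph_iff)
      ultimately show ?thesis by (force simp: H_def)
    qed
    ultimately show "C \<in> abs_graph_class ` ?R" by blast
  qed
qed

theorem ind_count_mult:
  "ind_count C1 * ind_count C2 =
     (\<Sum>C | num_verts C \<le> num_verts C1 + num_verts C2.
        fun_scale (of_nat (prod_coeff C1 C2 C)) (ind_count C))"
    (is "_ = (\<Sum>C\<in>?N. _)")
proof
  fix K
  obtain G where G: "pair_graph G" and K: "K = abs_graph_class G" using graph_class_cases by metis
  define cls where "cls S = abs_graph_class (induced G S)" for S
  let ?A = "\<lambda>S. {(S1, S2). S1 \<in> copies C1 G \<and> S2 \<in> copies C2 G \<and> S1 \<union> S2 = S}"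
  have A: "card (?A S) = prod_coeff C1 C2 (cls S)" if "S \<subseteq> pverts G" for S
    unfolding cls_def prod_coeff_eq_card[OF pair_graph_induced[OF G]] copies_induced[OF that]
    using that by (intro arg_cong[of _ _ card]) auto
  have fin: "finite (Pow (pverts G))" using pair_graph_finite[OF G] by simp
  \<comment> \<open>Double counting: pairs of copies are sorted by their union \<open>S\<close>, and
    those with union \<open>S\<close> are the covering pairs of \<open>G[S]\<close>.\<close>
  have "copies C1 G \<times> copies C2 G = (\<Union>S\<in>Pow (pverts G). ?A S)"
    by (auto simp: copies_def)
  also have "card \<dots> = (\<Sum>S\<in>Pow (pverts G). card (?A S))"
  proof (intro card_UN_disjoint fin ballI impI)
    fix S
    show "finite (?A S)"
      by (rule finite_subset[of _ "copies C1 G \<times> copies C2 G"]) (auto simp: finite_copies[OF G])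
  qed auto
  also have "\<dots> = (\<Sum>S\<in>Pow (pverts G). prod_coeff C1 C2 (cls S))"
    using A by (intro sum.cong) auto
  \<comment> \<open>Sets \<open>S\<close> whose class has too many vertices contribute 0.\<close>
  also have "\<dots> = (\<Sum>S\<in>{S \<in> Pow (pverts G). cls S \<in> ?N}. prod_coeff C1 C2 (cls S))"
    using num_verts_le_if_prod_coeff fin by (intro sum.mono_neutral_right) auto
  \<comment> \<open>Second sorting, by the isomorphism class of \<open>G[S]\<close>: the sets of
    class \<open>C\<close> are the copies of \<open>C\<close> in \<open>G\<close>.\<close>
  also have "\<dots> = (\<Sum>C\<in>?N. \<Sum>S\<in>{S \<in> {S \<in> Pow (pverts G). cls S \<in> ?N}. cls S = C}. prod_coeff C1 C2 (cls S))"
    using fin by (intro sum.group[symmetric] finite_num_verts_le) auto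
  also have "\<dots> = (\<Sum>C\<in>?N. \<Sum>S\<in>copies C G. prod_coeff C1 C2 C)"
    by (intro sum.cong) (auto simp: copies_def cls_def)
  finally have "card (copies C1 G) * card (copies C2 G) =
      (\<Sum>C\<in>?N. prod_coeff C1 C2 C * card (copies C G))"
    by (simp add: card_cartesian_product mult.commute)
  then have "rat_of_nat (card (copies C1 G) * card (copies C2 G)) =
      (\<Sum>C\<in>?N. of_nat (prod_coeff C1 C2 C) * of_nat (card (copies C G)))" by simp
  \<comment> \<open>A finite sum of functions is evaluated pointwise.\<close>
  moreover have "(\<Sum>C\<in>?N. f C) K = (\<Sum>C\<in>?N. f C K)" for f :: "graph_class \<Rightarrow> graph_class \<Rightarrow> rat"
    using finite_num_verts_le by (induction rule: finite_induct) auto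
  ultimately show "(ind_count C1 * ind_count C2) K =
      (\<Sum>C\<in>?N. fun_scale (of_nat (prod_coeff C1 C2 C)) (ind_count C)) K"
    by (simp add: K ind_count_eq_card_copies[OF G] fun_scale_def)
qed

section \<open>Splitting off connected components\<close>

text \<open>Tie-breaker in the induction for generation. Every edge counts twice, which does not
  affect comparisons.\<close>

lift_definition num_arcs :: "graph_class \<Rightarrow> nat" is "\<lambda>G. card (parcs G)"
proof -
  fix G H assume "graph_rel G H"
  then have G: "pair_graph G" and "digraph_iso (with_proj G) (with_proj H)"
    by (auto simp: graph_rel_def)
  then obtain f where f: "bij_betw f (pverts G) (pverts H)" "parcs H = map_prod f f ` parcs G"
    by (auto elim: digraph_isoE)
  have inj: "inj_on f (pverts G)" using f by (simp add: bij_betw_def)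
  have "inj_on (map_prod f f) (parcs G)"
    using map_prod_inj_on[OF inj inj] by (rule inj_on_subset) (use G in \<open>simp add: pair_graph_iff\<close>)
  then show "card (parcs G) = card (parcs H)" by (simp add: f(2) card_image)
qed

lemma num_arcs_abs: "pair_graph G \<Longrightarrow> num_arcs (abs_graph_class G) = card (parcs G)"
  by (simp add: num_arcs.abs_eq graph_rel_refl_iff)

text \<open>Bounds the arcs by a function of the vertices, so that having more arcs can serve as a
  descending measure.\<close>

lemma num_arcs_le: "num_arcs C \<le> (num_verts C)\<^sup>2"
proof -
  obtain G where G: "pair_graph G" "C = abs_graph_class G" using graph_class_cases by metis
  have "card (parcs G) \<le> card (pverts G \<times> pverts G)"
    using G(1) by (intro card_mono) (auto simp: pair_graph_iff)
  then show ?thesis using G by (simp add: num_arcs_abs num_verts_abs power2_eq_square card_cartesian_product)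
qed

text \<open>Take for \<open>S\<close> the vertices reachable from some \<open>u\<close> that does
  not reach every vertex. No arc leaves \<open>S\<close>, and by symmetry none enters it. The empty
  graph, also not connected, has no such split and is excluded.\<close>

lemma not_connected_split:
  assumes G: "pair_graph G" and "\<not> connected_class (abs_graph_class G)" and ne: "pverts G \<noteq> {}"
  obtains S where "S \<noteq> {}" "S \<subset> pverts G" "parcs G \<subseteq> S \<times> S \<union> (pverts G - S) \<times> (pverts G - S)"
proof -
  interpret pair_graph G by (rule G)
  have "\<not> connected (with_proj G)"
    using assms by (simp add: connected_class.abs_eq graph_rel_refl_iff)
  \<comment> \<open>\<open>connected\<close> refers to the symmetric closure, which has the same
    reachability here because the arcs are already symmetric.\<close>
  then obtain u v where uv: "u \<in> pverts G" "v \<in> pverts G" "\<not> u \<rightarrow>\<^sup>*\<^bsub>G\<^esub> v"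
    using ne reachable_mk_symmetric_eq[OF pair_sym_arcs]
    by (auto simp: connected_def strongly_connected_def)
  define S where "S = {w \<in> pverts G. u \<rightarrow>\<^sup>*\<^bsub>G\<^esub> w}"
  have step: "y \<in> S" if "x \<in> S" "(x, y) \<in> parcs G" for x y
    using that pair_graph_arcsD[OF G that(2)]
    by (auto simp: S_def intro: reachable_adj_trans)
  show ?thesis
  proof
    show "S \<noteq> {}" using uv by (auto simp: S_def)
    show "S \<subset> pverts G" using uv by (auto simp: S_def)
    show "parcs G \<subseteq> S \<times> S \<union> (pverts G - S) \<times> (pverts G - S)"
      using step pair_graph_arcsD[OF G] by fastforce
  qed
qed

lemma card_parcs_induced_disjoint:
  assumes "pair_graph G" "S \<inter> T = {}"
  shows "card (parcs G \<inter> (S \<times> S \<union> T \<times> T)) =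
    card (parcs (induced G S)) + card (parcs (induced G T))"
proof -
  have "parcs G \<inter> (S \<times> S \<union> T \<times> T) = parcs (induced G S) \<union> parcs (induced G T)" by auto
  also have "card \<dots> = card (parcs (induced G S)) + card (parcs (induced G T))"
    using assms by (intro card_Un_disjoint) (auto dest: pair_graph_finite_arcs)
  finally show ?thesis .
qed

text \<open>The isomorphisms of the two sides combine piecewise; pairs from different sides are
  non-arcs in both graphs.\<close>

lemma graph_rel_glue:
  assumes G: "pair_graph G" and H: "pair_graph H"
    and S: "S \<union> T = pverts G" "S \<inter> T = {}" "parcs G \<subseteq> S \<times> S \<union> T \<times> T"
    and S': "S' \<union> T' = pverts H" "S' \<inter> T' = {}" "parcs H \<subseteq> S' \<times> S' \<union> T' \<times> T'"
    and rS: "graph_rel (induced G S) (induced H S')" and rT: "graph_rel (induced G T) (induced H T')"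
  shows "graph_rel G H"
proof -
  have V: "S \<inter> pverts G = S" "T \<inter> pverts G = T" "S' \<inter> pverts H = S'" "T' \<inter> pverts H = T'"
    using S S' by auto
  obtain f where f: "bij_betw f S S'"
    and fe: "\<And>u v. u \<in> S \<Longrightarrow> v \<in> S \<Longrightarrow> (u, v) \<in> parcs G \<longleftrightarrow> (f u, f v) \<in> parcs H \<inter> S' \<times> S'"
    using rS V by (auto simp: graph_rel_iff)
  obtain g where g: "bij_betw g T T'"
    and ge: "\<And>u v. u \<in> T \<Longrightarrow> v \<in> T \<Longrightarrow> (u, v) \<in> parcs G \<longleftrightarrow> (g u, g v) \<in> parcs H \<inter> T' \<times> T'"
    using rT V by (auto simp: graph_rel_iff)
  define h where "h x = (if x \<in> S then f x else g x)" for x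
  have hS: "h x = f x" if "x \<in> S" for x using that by (simp add: h_def)
  have hT: "h x = g x" if "x \<in> T" for x using that S(2) by (auto simp: h_def)
  have fm: "f x \<in> S'" if "x \<in> S" for x using f that by (auto simp: bij_betw_def)
  have gm: "g x \<in> T'" if "x \<in> T" for x using g that by (auto simp: bij_betw_def)
  have "bij_betw h S S'" using f bij_betw_cong[of S h f S'] hS by blast
  moreover have "bij_betw h T T'" using g bij_betw_cong[of T h g T'] hT by blast
  ultimately have "bij_betw h (S \<union> T) (S' \<union> T')" using S'(2) by (rule bij_betw_combine)
  moreover have "(u, v) \<in> parcs G \<longleftrightarrow> (h u, h v) \<in> parcs H" if uv: "u \<in> S \<union> T" "v \<in> S \<union> T" for u v
  proof -
    consider "u \<in> S" "v \<in> S" | "u \<in> T" "v \<in> T" | "u \<in> S" "v \<in> T" | "u \<in> T" "v \<in> S"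
      using uv by auto
    then show ?thesis
    proof cases
      case 1 then show ?thesis using fe[of u v] fm by (simp add: hS)
    next
      case 2 then show ?thesis using ge[of u v] gm by (simp add: hT)
    next
      case 3
      then have "(u, v) \<notin> parcs G" "(f u, g v) \<notin> parcs H"
        using S(2,3) S'(2,3) fm[of u] gm[of v] by blast+
      then show ?thesis using 3 by (simp add: hS hT)
    next
      case 4
      then have "(u, v) \<notin> parcs G" "(g u, f v) \<notin> parcs H"
        using S(2,3) S'(2,3) fm[of v] gm[of u] by blast+
      then show ?thesis using 4 by (simp add: hS hT)
    qed
  qed
  ultimately show ?thesis
    unfolding graph_rel_iff S(1)[symmetric] S'(1)[symmetric] using G H
    by (intro conjI exI[of _ h] ballI) simp_all
qed

text \<open>The pair \<open>(S, T)\<close> itself covers \<open>G\<close>. For another graph with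
  nonzero coefficient, either the two copies overlap, which loses vertices, or they are disjoint and
  some arc runs between them, since otherwise the graph would be isomorphic to
  \<open>G\<close>.\<close>

lemma prod_coeff_disjoint_union:
  fixes C :: graph_class
  assumes G: "pair_graph G"
    and S: "S \<union> T = pverts G" "S \<inter> T = {}" "parcs G \<subseteq> S \<times> S \<union> T \<times> T"
    and A: "A = abs_graph_class (induced G S)" and B: "B = abs_graph_class (induced G T)"
  shows "prod_coeff A B (abs_graph_class G) \<noteq> 0"
    and "prod_coeff A B C \<noteq> 0 \<Longrightarrow> C \<noteq> abs_graph_class G \<Longrightarrow>
      num_verts C < card (pverts G) \<or> num_verts C = card (pverts G) \<and> card (parcs G) < num_arcs C"
proof -
  note pg = pair_graph_induced[OF G]
  have cA: "S \<in> copies A G" and cB: "T \<in> copies B G" using S by (auto simp: copies_def A B)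
  let ?P = "\<lambda>K. {(S, T). S \<in> copies A K \<and> T \<in> copies B K \<and> S \<union> T = pverts K}"
  have "finite (?P G)"
    by (rule finite_subset[of _ "copies A G \<times> copies B G"]) (auto simp: finite_copies[OF G])
  moreover have "(S, T) \<in> ?P G" using cA cB S by simp
  ultimately show "prod_coeff A B (abs_graph_class G) \<noteq> 0"
    unfolding prod_coeff_eq_card[OF G] by (metis (no_types, lifting) card_0_eq empty_iff)
  assume nz: "prod_coeff A B C \<noteq> 0" and ne: "C \<noteq> abs_graph_class G"
  obtain K where K: "pair_graph K" and C: "C = abs_graph_class K" using graph_class_cases by metis
  have "?P K \<noteq> {}" using nz unfolding C prod_coeff_eq_card[OF K] by (metis card.empty)
  then obtain S' T' where c: "S' \<in> copies A K" "T' \<in> copies B K" "S' \<union> T' = pverts K" by blast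
  note fin = pair_graph_finite[OF G] pair_graph_finite[OF K]
  have fST: "finite S" "finite T" "finite S'" "finite T'"
    using fin unfolding S(1)[symmetric] c(3)[symmetric] by simp_all
  have cS: "card S' = card S" "card T' = card T"
    using card_copy[OF K] card_copy[OF G] c cA cB by simp_all
  have nG: "card (pverts G) = card S + card T"
    using card_Un_disjoint[OF fST(1,2) S(2)] S(1) by simp
  \<comment> \<open>Inclusion-exclusion: the overlap is exactly the loss of vertices compared with
    \<open>G\<close>.\<close>
  have nK: "num_verts C + card (S' \<inter> T') = card (pverts G)"
    using card_Un_Int[OF fST(3,4)] c(3) cS nG by (simp add: C num_verts_abs[OF K])
  have eA: "abs_graph_class (induced G S) = abs_graph_class (induced K S')"
    and eB: "abs_graph_class (induced G T) = abs_graph_class (induced K T')"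
    using c by (simp_all add: copies_def A B)
  show "num_verts C < card (pverts G) \<or> num_verts C = card (pverts G) \<and> card (parcs G) < num_arcs C"
  proof (cases "S' \<inter> T' = {}")
    case False
    then have "card (S' \<inter> T') > 0" using fST by (simp add: card_gt_0_iff)
    then show ?thesis using nK by simp
  next
    case True
    \<comment> \<open>The arcs inside one of the two copies; there are as many as arcs of
      \<open>G\<close>, so any further arc is a crossing one.\<close>
    let ?I = "parcs K \<inter> (S' \<times> S' \<union> T' \<times> T')"
    have "card ?I = card (parcs (induced G S)) + card (parcs (induced G T))"
      using card_parcs_induced_disjoint[OF K True] arg_cong[OF eA, of num_arcs]
        arg_cong[OF eB, of num_arcs]
      by (simp add: num_arcs_abs pg pair_graph_induced[OF K])
    also have "\<dots> = card (parcs G)"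
      using card_parcs_induced_disjoint[OF G S(2)] S(3) by (simp add: Int_absorb2)
    finally have I: "card ?I = card (parcs G)" .
    have "\<not> parcs K \<subseteq> S' \<times> S' \<union> T' \<times> T'"
    proof
      assume "parcs K \<subseteq> S' \<times> S' \<union> T' \<times> T'"
      then have "graph_rel G K"
        using eA eB abs_graph_class_eq_iff[OF pg pair_graph_induced[OF K]]
        by (intro graph_rel_glue[OF G K S c(3) True]) simp_all
      then show False using ne abs_graph_class_eq_iff[OF G K] C by simp
    qed
    then have "?I \<subset> parcs K" by blast
    then have "card ?I < card (parcs K)"
      using pair_graph_finite_arcs[OF K] by (rule psubset_card_mono[rotated])
    then show ?thesis using nK True I by (simp add: C num_arcs_abs[OF K])
  qed
qed

text \<open>Only the empty set is a copy of the empty graph. This puts the unit into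
  \<open>P_space\<close> and settles the empty graph in the induction for generation.\<close>

lemma ind_count_empty: "ind_count (abs_graph_class empty_graph) = 1"
proof
  fix K
  obtain G where G: "pair_graph G" and K: "K = abs_graph_class G" using graph_class_cases by metis
  have "copies (abs_graph_class empty_graph) G = {{}}"
  proof -
    have "S = {}" if "S \<in> copies (abs_graph_class empty_graph) G" for S
      using card_copy[OF G that] that finite_subset[OF _ pair_graph_finite[OF G], of S]
      by (auto simp: num_verts_abs[OF pair_graph_empty] copies_def)
        (simp_all add: empty_graph_def)
    moreover have "induced G {} = empty_graph" by (simp add: induced_def empty_graph_def)
    ultimately show ?thesis by (auto simp: copies_def)
  qed
  then show "ind_count (abs_graph_class empty_graph) K = 1 K"
    by (simp add: K ind_count_eq_card_copies[OF G])
qed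

section \<open>Generation by the connected graphs\<close>

lemma fun_scale_mult_left: "fun_scale c f * g = fun_scale c (f * g)"
  and fun_scale_mult_right: "f * fun_scale c g = fun_scale c (f * g)"
  by (auto simp: fun_scale_def)

text \<open>Subalgebras are closed under intersection, so the hull is itself one: the generated
  subalgebra.\<close>

lemma rat_subalgebra_hull: "rat_subalgebra (rat_subalgebra hull X)"
  by (rule hull_in) (auto simp: rat_subalgebra_def intro: rat_fun.subspace_Inter)

text \<open>Closure under products extends bilinearly from the product formula on the spanning
  functions, one factor at a time.\<close>

lemma rat_subalgebra_P_space: "rat_subalgebra P_space"
proof -
  have sub: "rat_fun.subspace P_space" unfolding P_space_def by (rule rat_fun.subspace_span)
  have basis: "ind_count C \<in> P_space" for C unfolding P_space_def by (rule rat_fun.span_base) simp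
  \<comment> \<open>Linearity in one factor, in the form that induction over a span
    requires.\<close>
  have lin: "rat_fun.subspace {f. f * g \<in> P_space}" for g
    using sub by (auto simp: rat_fun.subspace_def distrib_right fun_scale_mult_left)
  have 1: "f * ind_count C \<in> P_space" if "f \<in> P_space" for f C
    using that[unfolded P_space_def]
  proof (induction f rule: rat_fun.span_induct)
    case base
    show ?case by (rule lin)
  next
    case (step f)
    then obtain D where f: "f = ind_count D" by blast
    show ?case
      unfolding f ind_count_mult
      by (intro rat_fun.subspace_sum[OF sub] rat_fun.subspace_scale[OF sub] basis)
  qed
  have 2: "g * f \<in> P_space" if "f \<in> P_space" "g \<in> P_space" for f g
    using that(2)[unfolded P_space_def]
  proof (induction g rule: rat_fun.span_induct)
    case base
    show ?case by (rule lin)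
  next
    case (step g)
    then obtain C where g: "g = ind_count C" by blast
    show ?case unfolding g by (subst mult.commute) (rule 1[OF that(1)])
  qed
  show ?thesis
    unfolding rat_subalgebra_def
    using sub basis[of "abs_graph_class empty_graph"] 2 by (auto simp: ind_count_empty)
qed

text \<open>The induction is lexicographic: fewer vertices first, then more arcs on the same number
  of vertices.\<close>

lemma ind_count_in_hull: "ind_count C \<in> rat_subalgebra hull connected_funs"
proof (induction C rule: wf_induct_rule[OF wf_measures[of
      "[num_verts, \<lambda>C. (num_verts C)\<^sup>2 - num_arcs C]"]])
  case (1 C)
  let ?X = "rat_subalgebra hull connected_funs"
  have X: "rat_fun.subspace ?X" "1 \<in> ?X" "\<And>f g. f \<in> ?X \<Longrightarrow> g \<in> ?X \<Longrightarrow> f * g \<in> ?X"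
    using rat_subalgebra_hull[of connected_funs] by (auto simp: rat_subalgebra_def)
  \<comment> \<open>The subtraction in the measure is truncated; it decreases strictly because
    \<open>num_arcs_le\<close> bounds the arcs of \<open>D\<close>.\<close>
  have IH: "ind_count D \<in> ?X" if "num_verts D < num_verts C \<or>
      num_verts D = num_verts C \<and> num_arcs C < num_arcs D" for D
    using that num_arcs_le[of D] by (intro 1) auto
  obtain G where G: "pair_graph G" and C: "C = abs_graph_class G" using graph_class_cases by metis
  consider "connected_class C" | "pverts G = {}" | "\<not> connected_class C" "pverts G \<noteq> {}" by blast
  then show ?case
  proof cases
    case 1
    then show ?thesis by (intro hull_inc) (simp add: connected_funs_def)
  next
    case 2
    then have "G = empty_graph" using G by (cases G) (auto simp: pair_graph_iff empty_graph_def)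
    then show ?thesis using X(2) by (simp only: C ind_count_empty)
  next
    case 3
    then obtain S where S: "S \<noteq> {}" "S \<subset> pverts G"
      "parcs G \<subseteq> S \<times> S \<union> (pverts G - S) \<times> (pverts G - S)"
      using not_connected_split[OF G] by (auto simp: C)
    define A where "A = abs_graph_class (induced G S)"
    define B where "B = abs_graph_class (induced G (pverts G - S))"
    have S': "S \<union> (pverts G - S) = pverts G" "S \<inter> (pverts G - S) = {}" using S by auto
    note * = prod_coeff_disjoint_union[OF G S' S(3) A_def B_def]
    have finG: "finite (pverts G)" using G by (rule pair_graph_finite)
    have "card S < card (pverts G)" using S finG by (intro psubset_card_mono)
    moreover have "card (pverts G - S) < card (pverts G)"
      using S finG by (intro psubset_card_mono) auto
    ultimately have "num_verts A < num_verts C" "num_verts B < num_verts C"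
      using G psubset_imp_subset[OF S(2)] Int_absorb2[of S "pverts G"]
        Int_absorb2[of "pverts G - S" "pverts G"]
      by (simp_all add: A_def B_def C num_verts_abs pair_graph_induced)
    then have AB: "ind_count A * ind_count B \<in> ?X" using IH X(3) by blast
    let ?N = "{D. num_verts D \<le> num_verts A + num_verts B}"
    let ?t = "\<lambda>D. fun_scale (of_nat (prod_coeff A B D)) (ind_count D)"
    have CN: "C \<in> ?N" using num_verts_le_if_prod_coeff *(1) by (simp add: C)
    \<comment> \<open>Every term except that of \<open>C\<close> itself vanishes or falls under the
      induction hypothesis.\<close>
    have "?t D \<in> ?X" if "D \<noteq> C" for D
    proof (cases "prod_coeff A B D = 0")
      case True
      then show ?thesis using rat_fun.subspace_0[OF X(1)] by (simp add: rat_fun.scale_zero_left)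
    next
      case False
      then have "ind_count D \<in> ?X"
        using *(2)[of D] that G by (intro IH) (simp add: C num_verts_abs num_arcs_abs)
      then show ?thesis by (rule rat_fun.subspace_scale[OF X(1)])
    qed
    then have rest: "(\<Sum>D\<in>?N - {C}. ?t D) \<in> ?X" by (intro rat_fun.subspace_sum[OF X(1)]) auto
    have "ind_count A * ind_count B = ?t C + (\<Sum>D\<in>?N - {C}. ?t D)"
      unfolding ind_count_mult by (rule sum.remove[OF finite_num_verts_le CN])
    then have "?t C = ind_count A * ind_count B - (\<Sum>D\<in>?N - {C}. ?t D)" by simp
    then have "?t C \<in> ?X" using rat_fun.subspace_diff[OF X(1) AB rest] by simp
    \<comment> \<open>The coefficient of \<open>C\<close> is nonzero, so it can be divided out over
      the rationals.\<close>
    then have "fun_scale (inverse (of_nat (prod_coeff A B C))) (?t C) \<in> ?X"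
      by (rule rat_fun.subspace_scale[OF X(1)])
    then show ?thesis using *(1) by (simp add: C)
  qed
qed

theorem P_space_eq_hull: "P_space = rat_subalgebra hull connected_funs"
proof
  show "P_space \<subseteq> rat_subalgebra hull connected_funs"
    unfolding P_space_def using rat_subalgebra_hull[of connected_funs] ind_count_in_hull
    by (intro rat_fun.span_minimal) (auto simp: rat_subalgebra_def)
  show "rat_subalgebra hull connected_funs \<subseteq> P_space"
    using rat_subalgebra_P_space
    by (intro hull_minimal) (auto simp: connected_funs_def P_space_def intro: rat_fun.span_base)
qed

section \<open>Evaluating polynomials\<close>

text \<open>Substitution of functions for variables, with pointwise products. In the application
  \<open>\<rho>\<close> is \<open>id\<close>, because the variables are the functions
  \<open>[H]\<close> themselves.\<close>

definition monom_eval :: "('v \<Rightarrow> 'a \<Rightarrow> rat) \<Rightarrow> ('v \<Rightarrow>\<^sub>0 nat) \<Rightarrow> 'a \<Rightarrow> rat" where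
  "monom_eval \<rho> m = (\<Prod>v\<in>Poly_Mapping.keys m. \<rho> v ^ Poly_Mapping.lookup m v)"

definition mpoly_eval :: "('v \<Rightarrow> 'a \<Rightarrow> rat) \<Rightarrow> (('v \<Rightarrow>\<^sub>0 nat) \<Rightarrow>\<^sub>0 rat) \<Rightarrow> 'a \<Rightarrow> rat" where
  "mpoly_eval \<rho> p =
    (\<Sum>m\<in>Poly_Mapping.keys p. fun_scale (Poly_Mapping.lookup p m) (monom_eval \<rho> m))"

text \<open>Extra variables have exponent 0 and contribute a factor 1. This allows one index set for
  several monomials.\<close>

lemma monom_eval_superset:
  assumes "finite A" "Poly_Mapping.keys m \<subseteq> A"
  shows "monom_eval \<rho> m = (\<Prod>v\<in>A. \<rho> v ^ Poly_Mapping.lookup m v)"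
  unfolding monom_eval_def using assms by (intro prod.mono_neutral_left) (auto simp: in_keys_iff)

lemma monom_eval_add: "monom_eval \<rho> (m + n) = monom_eval \<rho> m * monom_eval \<rho> n"
proof -
  let ?A = "Poly_Mapping.keys m \<union> Poly_Mapping.keys n"
  have "monom_eval \<rho> (m + n) = (\<Prod>v\<in>?A. \<rho> v ^ Poly_Mapping.lookup (m + n) v)"
    using keys_add[of m n] by (intro monom_eval_superset) auto
  also have "\<dots> = (\<Prod>v\<in>?A. \<rho> v ^ Poly_Mapping.lookup m v) * (\<Prod>v\<in>?A. \<rho> v ^ Poly_Mapping.lookup n v)"
    by (simp add: lookup_add power_add prod.distrib)
  also have "\<dots> = monom_eval \<rho> m * monom_eval \<rho> n"
    by (simp add: monom_eval_superset[of ?A])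
  finally show ?thesis .
qed

lemma mpoly_eval_superset:
  assumes "finite A" "Poly_Mapping.keys p \<subseteq> A"
  shows "mpoly_eval \<rho> p = (\<Sum>m\<in>A. fun_scale (Poly_Mapping.lookup p m) (monom_eval \<rho> m))"
  unfolding mpoly_eval_def using assms by (intro sum.mono_neutral_left) (auto simp: in_keys_iff)

lemma mpoly_eval_add: "mpoly_eval \<rho> (p + q) = mpoly_eval \<rho> p + mpoly_eval \<rho> q"
proof -
  let ?A = "Poly_Mapping.keys p \<union> Poly_Mapping.keys q"
  have "mpoly_eval \<rho> (p + q) =
      (\<Sum>m\<in>?A. fun_scale (Poly_Mapping.lookup (p + q) m) (monom_eval \<rho> m))"
    using keys_add[of p q] by (intro mpoly_eval_superset) auto
  also have "\<dots> = (\<Sum>m\<in>?A. fun_scale (Poly_Mapping.lookup p m) (monom_eval \<rho> m)) +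
      (\<Sum>m\<in>?A. fun_scale (Poly_Mapping.lookup q m) (monom_eval \<rho> m))"
    by (simp add: lookup_add rat_fun.scale_left_distrib sum.distrib)
  also have "\<dots> = mpoly_eval \<rho> p + mpoly_eval \<rho> q"
    by (simp add: mpoly_eval_superset[of ?A])
  finally show ?thesis .
qed

lemma mpoly_eval_0 [simp]: "mpoly_eval \<rho> 0 = 0"
  by (simp add: mpoly_eval_def)

lemma mpoly_eval_sum: "mpoly_eval \<rho> (\<Sum>i\<in>I. p i) = (\<Sum>i\<in>I. mpoly_eval \<rho> (p i))"
  by (induction I rule: infinite_finite_induct) (auto simp: mpoly_eval_add)

lemma mpoly_eval_single: "mpoly_eval \<rho> (Poly_Mapping.single m c) = fun_scale c (monom_eval \<rho> m)"
  by (cases "c = 0") (simp_all add: mpoly_eval_def)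

lemma mpoly_eval_1: "mpoly_eval \<rho> 1 = 1"
  using mpoly_eval_single[of \<rho> 0 1] by (simp add: monom_eval_def)

text \<open>Splits a polynomial into its terms, which reduces multiplicativity of evaluation to
  monomials.\<close>

lemma sum_single_lookup:
  fixes p :: "'a \<Rightarrow>\<^sub>0 'b :: comm_monoid_add"
  shows "(\<Sum>m\<in>Poly_Mapping.keys p. Poly_Mapping.single m (Poly_Mapping.lookup p m)) = p"
  by (intro poly_mapping_eqI)
    (auto simp: lookup_sum lookup_single when_def in_keys_iff if_distrib cong: if_cong)

lemma mpoly_eval_mult: "mpoly_eval \<rho> (p * q) = mpoly_eval \<rho> p * mpoly_eval \<rho> q"
proof -
  let ?s = "\<lambda>p m. Poly_Mapping.single m (Poly_Mapping.lookup p m)"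
  have "p * q = (\<Sum>m\<in>Poly_Mapping.keys p. ?s p m) * (\<Sum>n\<in>Poly_Mapping.keys q. ?s q n)"
    by (simp add: sum_single_lookup)
  also have "mpoly_eval \<rho> \<dots> = (\<Sum>m\<in>Poly_Mapping.keys p. \<Sum>n\<in>Poly_Mapping.keys q.
      mpoly_eval \<rho> (?s p m) * mpoly_eval \<rho> (?s q n))"
    by (simp add: sum_product mpoly_eval_sum mult_single mpoly_eval_single monom_eval_add
        fun_scale_mult_left fun_scale_mult_right mult.commute)
  also have "\<dots> = mpoly_eval \<rho> (\<Sum>m\<in>Poly_Mapping.keys p. ?s p m) *
      mpoly_eval \<rho> (\<Sum>n\<in>Poly_Mapping.keys q. ?s q n)"
    by (simp only: sum_product mpoly_eval_sum)
  finally show ?thesis by (simp add: sum_single_lookup)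
qed

text \<open>Scaling is multiplication by a constant polynomial, so this follows from
  multiplicativity.\<close>

lemma mpoly_eval_scale: "mpoly_eval \<rho> (Poly_Mapping.map ((*) c) p) = fun_scale c (mpoly_eval \<rho> p)"
  by (simp add: mult_map_scale_conv_mult mpoly_eval_mult mpoly_eval_single fun_scale_mult_left
      monom_eval_def)

lemma mpoly_eval_var: "mpoly_eval \<rho> (mpoly_var v) = \<rho> v"
  by (simp add: mpoly_var_def mpoly_eval_single monom_eval_def)

section \<open>The polynomial algebra on a set of variables and the image of evaluation\<close>

lemma mpoly_alg_simps [simp]:
  "carrier (mpoly_alg V) = {p. \<forall>m\<in>Poly_Mapping.keys p. Poly_Mapping.keys m \<subseteq> V}"
  "mult (mpoly_alg V) = (*)" "one (mpoly_alg V) = 1" "zero (mpoly_alg V) = 0"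
  "add (mpoly_alg V) = (+)" "smult (mpoly_alg V) = (\<lambda>c. Poly_Mapping.map ((*) c))"
  by (simp_all add: mpoly_alg_def)

lemma mpoly_alg_closed:
  assumes "p \<in> carrier (mpoly_alg V)" "q \<in> carrier (mpoly_alg V)"
  shows "p + q \<in> carrier (mpoly_alg V)" "p * q \<in> carrier (mpoly_alg V)"
proof -
  show "p + q \<in> carrier (mpoly_alg V)" using assms keys_add[of p q] by auto
  show "p * q \<in> carrier (mpoly_alg V)"
  proof (simp, intro ballI)
    fix m assume "m \<in> Poly_Mapping.keys (p * q)"
    then obtain a b where m: "m = a + b" "a \<in> Poly_Mapping.keys p" "b \<in> Poly_Mapping.keys q"
      using keys_mult[of p q] by blast
    then have "Poly_Mapping.keys a \<subseteq> V" "Poly_Mapping.keys b \<subseteq> V" using assms by auto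
    then show "Poly_Mapping.keys m \<subseteq> V" using keys_add[of a b] m(1) by blast
  qed
qed

lemma mpoly_alg_scale_closed:
  "p \<in> carrier (mpoly_alg V) \<Longrightarrow> Poly_Mapping.map ((*) c) p \<in> carrier (mpoly_alg V)"
  unfolding mult_map_scale_conv_mult by (intro mpoly_alg_closed) auto

lemma mpoly_var_closed: "v \<in> V \<Longrightarrow> mpoly_var v \<in> carrier (mpoly_alg V)"
  by (simp add: mpoly_var_def)

lemma cring_mpoly_alg: "cring (mpoly_alg V)"
proof (rule cringI)
  show "abelian_group (mpoly_alg V)"
  proof (rule abelian_groupI)
    fix p assume p: "p \<in> carrier (mpoly_alg V)"
    have "- p \<in> carrier (mpoly_alg V)" using p by (auto simp: in_keys_iff)
    then show "\<exists>q\<in>carrier (mpoly_alg V). q \<oplus>\<^bsub>mpoly_alg V\<^esub> p = \<zero>\<^bsub>mpoly_alg V\<^esub>"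
      by (intro bexI[of _ "- p"]) simp_all
  qed (use mpoly_alg_closed in \<open>simp_all add: algebra_simps\<close>)
  show "comm_monoid (mpoly_alg V)"
    by (rule comm_monoidI) (use mpoly_alg_closed in \<open>simp_all add: algebra_simps\<close>)
qed (simp add: algebra_simps)

lemma mpoly_eval_in_subalgebra:
  assumes X: "rat_subalgebra X" and \<rho>: "\<rho> ` V \<subseteq> X" and p: "p \<in> carrier (mpoly_alg V)"
  shows "mpoly_eval \<rho> p \<in> X"
proof -
  have mult: "f * g \<in> X" if "f \<in> X" "g \<in> X" for f g using X that by (simp add: rat_subalgebra_def)
  have one: "1 \<in> X" and sub: "rat_fun.subspace X" using X by (simp_all add: rat_subalgebra_def)
  have pow: "f ^ n \<in> X" if "f \<in> X" for f and n :: nat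
    using that by (induction n) (auto intro: mult one)
  have "(\<Prod>v\<in>I. \<rho> v ^ e v) \<in> X" if "I \<subseteq> V" for I and e :: "_ \<Rightarrow> nat"
    using that \<rho> by (induction I rule: infinite_finite_induct) (auto intro!: mult one pow)
  then show ?thesis
    unfolding mpoly_eval_def monom_eval_def using p
    by (intro rat_fun.subspace_sum[OF sub] rat_fun.subspace_scale[OF sub]) auto
qed

text \<open>Values of polynomials lie in every subalgebra that contains the values of the variables.
  Conversely, the image is such a subalgebra, so minimality of the hull applies.\<close>

lemma mpoly_eval_image:
  "mpoly_eval \<rho> ` carrier (mpoly_alg V) = rat_subalgebra hull (\<rho> ` V)" (is "?I = _")
proof
  show "?I \<subseteq> rat_subalgebra hull (\<rho> ` V)"
    using mpoly_eval_in_subalgebra[OF rat_subalgebra_hull hull_subset] by blast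
  have "rat_subalgebra ?I"
    unfolding rat_subalgebra_def rat_fun.subspace_def
  proof (intro conjI ballI allI)
    show "0 \<in> ?I" by (rule image_eqI[of _ _ 0]) simp_all
    show "1 \<in> ?I" by (rule image_eqI[of _ _ 1]) (simp_all add: mpoly_eval_1)
    fix f g assume "f \<in> ?I" "g \<in> ?I"
    then obtain p q where p: "p \<in> carrier (mpoly_alg V)" "f = mpoly_eval \<rho> p"
      and q: "q \<in> carrier (mpoly_alg V)" "g = mpoly_eval \<rho> q" by blast
    show "f + g \<in> ?I" unfolding p(2) q(2) mpoly_eval_add[symmetric]
      by (intro imageI mpoly_alg_closed p(1) q(1))
    show "f * g \<in> ?I" unfolding p(2) q(2) mpoly_eval_mult[symmetric]
      by (intro imageI mpoly_alg_closed p(1) q(1))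
  next
    fix c f assume "f \<in> ?I"
    then show "fun_scale c f \<in> ?I"
      by (auto simp: mpoly_eval_scale[symmetric] simp del: mpoly_alg_simps
          intro!: imageI mpoly_alg_scale_closed)
  qed
  moreover have "\<rho> ` V \<subseteq> ?I"
    using mpoly_var_closed mpoly_eval_var by (metis imageI image_subsetI)
  ultimately show "rat_subalgebra hull (\<rho> ` V) \<subseteq> ?I" by (rule hull_minimal[rotated])
qed

section \<open>The algebra $\mathcal P$ as a quotient\<close>

lemma P_alg_simps [simp]:
  "carrier P_alg = P_space" "mult P_alg = (*)" "one P_alg = 1" "zero P_alg = 0"
  "add P_alg = (+)" "smult P_alg = fun_scale"
  by (simp_all add: P_alg_def)

lemma cring_P_alg: "cring P_alg"
proof (rule cringI)
  have sub: "rat_fun.subspace P_space" and one: "1 \<in> P_space"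
    and mult: "\<And>f g. f \<in> P_space \<Longrightarrow> g \<in> P_space \<Longrightarrow> f * g \<in> P_space"
    using rat_subalgebra_P_space by (simp_all only: rat_subalgebra_def)
  show "abelian_group P_alg"
  proof (rule abelian_groupI; unfold P_alg_simps)
    fix f assume "f \<in> P_space"
    then show "\<exists>g\<in>P_space. g + f = 0"
      by (intro bexI[of _ "- f"] rat_fun.subspace_neg[OF sub]) simp_all
  qed (use sub in \<open>auto simp: add_ac rat_fun.subspace_0 rat_fun.subspace_add\<close>)
  show "comm_monoid P_alg"
    by (rule comm_monoidI; unfold P_alg_simps)
      (simp_all only: mult one mult_ac mult_1_left mult_1_right)
qed (simp only: P_alg_simps distrib_right)

lemma algebra_P_alg: "algebra rat_ring P_alg"
proof (rule algebraI)
  show "cring rat_ring"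
    by (rule cringI)
      (auto intro!: abelian_groupI comm_monoidI exI[of _ "- x" for x]
        simp: rat_ring_def algebra_simps)
  show "cring P_alg" by (rule cring_P_alg)
  fix c f assume "f \<in> carrier P_alg"
  then show "c \<odot>\<^bsub>P_alg\<^esub> f \<in> carrier P_alg"
    using rat_subalgebra_P_space by (simp add: rat_subalgebra_def rat_fun.subspace_scale)
qed (simp_all add: rat_ring_def rat_fun.scale_left_distrib rat_fun.scale_right_distrib
    fun_scale_mult_left)

theorem proposition1p1:
  shows "algebra rat_ring P_alg \<and>
    (\<forall>H1 H2 :: graph_class.
       ind_count H1 * ind_count H2 =
         (\<Sum>H | num_verts H \<le> num_verts H1 + num_verts H2.
            fun_scale (of_nat (prod_coeff H1 H2 H)) (ind_count H))) \<and>
    (\<exists>\<phi>. \<phi> \<in> rat_alg_hom (mpoly_alg connected_funs) P_alg \<and>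
       (\<forall>h\<in>connected_funs. \<phi> (mpoly_var h) = h) \<and>
       \<phi> ` carrier (mpoly_alg connected_funs) = carrier P_alg \<and>
       mpoly_alg connected_funs Quot a_kernel (mpoly_alg connected_funs) P_alg \<phi> \<simeq> P_alg) \<and>
    P_space = rat_subalgebra hull connected_funs"
proof (intro conjI allI exI[of _ "mpoly_eval id"] ballI)
  let ?M = "mpoly_alg connected_funs"
  \<comment> \<open>Surjectivity is the generation result \<open>P_space_eq_hull\<close>, read
    through the description of the image of evaluation.\<close>
  show image: "mpoly_eval id ` carrier ?M = carrier P_alg"
    by (simp only: mpoly_eval_image P_space_eq_hull[symmetric] image_id id_apply P_alg_simps)
  then have closed: "mpoly_eval id p \<in> carrier P_alg" if "p \<in> carrier ?M" for p using that by blast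
  have hom: "mpoly_eval id \<in> ring_hom ?M P_alg"
    by (rule ring_hom_memI)
      (rule closed, assumption, simp_all only: mpoly_alg_simps P_alg_simps mpoly_eval_mult
        mpoly_eval_add mpoly_eval_1)
  then show "mpoly_eval id \<in> rat_alg_hom ?M P_alg"
    by (simp add: rat_alg_hom_def mpoly_eval_scale)
  have "ring_hom_ring ?M P_alg (mpoly_eval id)"
    using cring_mpoly_alg cring_P_alg hom by (intro ring_hom_ringI2) (auto intro: cring.axioms(1))
  \<comment> \<open>First isomorphism theorem for rings, applied to the surjection
    \<open>mpoly_eval id\<close>.\<close>
  then show "?M Quot a_kernel ?M P_alg (mpoly_eval id) \<simeq> P_alg"
    using image by (rule ring_hom_ring.FactRing_iso)
  show "mpoly_eval id (mpoly_var h) = h" for h :: "graph_class \<Rightarrow> rat"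
    by (simp only: mpoly_eval_var id_apply)
qed (fact algebra_P_alg ind_count_mult P_space_eq_hull)+

end
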